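(* Let $b=1$ and $T(z)=\sum_{n\ge1}n^{n-1}z^n/n!$. Then $$FC(z,w,q)=\frac{\bigl((1-T(zwq))^2-(1-T(zw))^2\bigr)T(zw)}{2z(1-q)(1-T(zw))}.$$
   Context: Bucket capacity $b=1$. An almost full table of length $m$ is a hash table with $m$ buckets $1,\dots,m$ (cyclic) and $m-1$ keys labelled $1,\dots,m-1$ with hash addresses in $\{1,\dots,m\}$, inserted in label order by linear probing (each key placed in the first empty bucket among $h(x),h(x)+1,\dots$ cyclically, never moved), such that bucket $m$ ends empty. The displacement of a key is the number of buckets it passes beyond its hash address. $FC(z,w,q)=\sum_{m\ge2}\sum q^{\text{displacement of }\bullet}\,w^m\frac{z^{m-1}}{(m-1)!}$, where the inner sum runs over all almost full tables of length $m$ together with a marked key $\bullet$ among the $m-1$ keys. *)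

theory Defs
  imports
    "HOL-Computational_Algebra.Formal_Laurent_Series"
    "HOL-Library.FuncSet"
begin

section \<open>Linear probing with bucket capacity 1\<close>

text \<open>
  A table of length \<open>m\<close> has the buckets \<open>1, \<dots>, m\<close> in cyclic order.  A hash table is given by its
  hash function \<open>h\<close>: the keys \<open>1, 2, \<dots>\<close> are inserted in this order and are never moved, so \<open>h\<close>
  determines the insertion process.
\<close>

definition bucket :: "nat \<Rightarrow> nat \<Rightarrow> nat \<Rightarrow> nat" where
  "bucket m a i = (a - 1 + i) mod m + 1"

text \<open>
  Number of buckets passed by a key with hash address \<open>a\<close> when \<open>S\<close> is the set of occupied buckets
  (used only when some bucket is empty).
\<close>

definition probe :: "nat \<Rightarrow> nat set \<Rightarrow> nat \<Rightarrow> nat" where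
  "probe m S a = (LEAST i. bucket m a i \<notin> S)"

text \<open>The set of buckets occupied after the keys \<open>1, \<dots>, k\<close> have been inserted.\<close>

fun occupied :: "nat \<Rightarrow> (nat \<Rightarrow> nat) \<Rightarrow> nat \<Rightarrow> nat set" where
  "occupied m h 0 = {}"
| "occupied m h (Suc k) =
     (let S = occupied m h k; a = h (Suc k)
      in insert (bucket m a (probe m S a)) S)"

definition displacement :: "nat \<Rightarrow> (nat \<Rightarrow> nat) \<Rightarrow> nat \<Rightarrow> nat" where
  "displacement m h x = probe m (occupied m h (x - 1)) (h x)"

definition almost_full_tables :: "nat \<Rightarrow> (nat \<Rightarrow> nat) set" where
  "almost_full_tables m =
     {h \<in> {1..m - 1} \<rightarrow>\<^sub>E {1..m}. m \<notin> occupied m h (m - 1)}"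

section \<open>The generating functions\<close>

text \<open>
  The series \<open>FC\<close> as a formal power series in \<open>z\<close>, with \<open>w\<close> and \<open>q\<close> in the coefficient field.
  The coefficient of \<open>z ^ n\<close> comes from the tables of length \<open>m = n + 1\<close>, and \<open>m \<ge> 2\<close> means \<open>n \<ge> 1\<close>;
  the inner sum is over the pairs of a table \<open>h\<close> and a marked key \<open>x\<close>.
\<close>

definition FC :: "'a \<Rightarrow> 'a \<Rightarrow> 'a :: field_char_0 fps" where
  "FC w q = Abs_fps (\<lambda>n.
     if n = 0 then 0
     else let m = n + 1 in
       (\<Sum>(h, x) \<in> almost_full_tables m \<times> {1..m - 1}. q ^ displacement m h x)
         * w ^ m / fact (m - 1))"

definition tree_fps :: "'a :: field_char_0 fps" where
  "tree_fps = Abs_fps (\<lambda>n. if n = 0 then 0 else of_nat (n ^ (n - 1)) / fact n)"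

text \<open>\<open>T (z * c)\<close> for a coefficient \<open>c\<close>, as a Laurent series in \<open>z\<close>.\<close>

definition T_at :: "'a \<Rightarrow> 'a :: field_char_0 fls" where
  "T_at c = fps_to_fls (tree_fps oo (fps_X * fps_const c))"

text \<open>
  The three formal variables, in the iterated Laurent series field \<open>\<rat>((q))((w))((z))\<close>.  Since this
  is a field, the quotient in the theorem, whose denominator involves \<open>z\<close> and \<open>1 - q\<close>, is an
  ordinary field division; the ring of formal power series \<open>\<rat>[[q]][[w]][[z]]\<close> is a subring.
\<close>

type_synonym coeff_wq = "rat fls fls"

definition var_q :: coeff_wq where
  "var_q = fls_const fls_X"

definition var_w :: coeff_wq where
  "var_w = fls_X"

definition var_z :: "coeff_wq fls" where
  "var_z = fls_X"

end

theory Submission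
  imports Defs
begin

text \<open>
  By rotational symmetry, the almost full tables of length \<open>m\<close> may be replaced by all hash functions
  of \<open>m - 1\<close> keys, up to the factor \<open>m\<close>, and so the keys after the marked key \<open>k\<close> only contribute a
  power of \<open>m\<close>.  Rotating the bucket filled by the key \<open>k\<close> to position \<open>m\<close>, its displacement is
  uniform on \<open>0, \<dots>, j - 1\<close>, where \<open>j - 1\<close> is the length of the block of full buckets that ends
  just before \<open>m\<close>.  The fillings of this block and of the rest of the table are counted independently,
  and the sum over \<open>k\<close> telescopes:
  \<open>\<Sum> q ^ displacement = \<Sum>j. (n choose j) j ^ (j - 2) (1 + q + \<dots> + q ^ (j - 1)) (m - j) ^ (n - j)\<close>
  with \<open>n = m - 1\<close>.  Hence \<open>FC = S T'\<close>, where \<open>T = T(z w)\<close> and \<open>S\<close> is the exponential generating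
  function of \<open>j ^ (j - 2) w ^ j (1 - q ^ j) / (1 - q)\<close>.  The case \<open>q = 1\<close>, in which every table has
  weight \<open>n\<close>, yields \<open>z T' (1 - T) = T\<close>.  Therefore \<open>z\<close> times the derivative of \<open>(1 - T)\<^sup>2\<close> is
  \<open>-2 T\<close>, which identifies \<open>2 (1 - q) S\<close> with \<open>(1 - T(z w q))\<^sup>2 - (1 - T(z w))\<^sup>2\<close>.
\<close>

declare One_nat_def [simp del]

section \<open>Rotations of the buckets and of whole tables\<close>

abbreviation hash_functions :: "nat \<Rightarrow> nat \<Rightarrow> (nat \<Rightarrow> nat) set" where
  "hash_functions m k \<equiv> {1..k} \<rightarrow>\<^sub>E {1..m}"

lemma bucket_in: "m > 0 \<Longrightarrow> bucket m a i \<in> {1..m}"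
  unfolding bucket_def using mod_less_divisor[of m "a - 1 + i"] by (auto simp: Suc_le_eq simp flip: Suc_eq_plus1)

lemma bucket_bucket: "bucket m (bucket m a i) j = bucket m a (i + j)"
  by (simp add: bucket_def mod_add_left_eq add.assoc)

lemma bucket_surj:
  assumes "a \<in> {1..m}" "b \<in> {1..m}"
  shows "\<exists>i<m. bucket m a i = b"
proof -
  \<comment> \<open>The cyclic distance from \<open>a\<close> to \<open>b\<close>; adding
    \<open>m\<close> first keeps the subtraction from truncating.\<close>
  define i where "i = (b + m - a) mod m"
  have "(a - 1 + i) mod m = (a - 1 + (b + m - a)) mod m"
    unfolding i_def by (simp add: mod_add_right_eq)
  also have "a - 1 + (b + m - a) = b - 1 + m" using assms by auto
  finally have "bucket m a i = (b - 1) mod m + 1" by (simp add: bucket_def)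
  also have "(b - 1) mod m = b - 1" using assms(2) by (intro mod_less) auto
  finally have "bucket m a i = b" using assms(2) by simp
  moreover have "i < m" using assms by (simp add: i_def)
  ultimately show ?thesis by blast
qed

lemma bij_betw_bucket:
  assumes "m > 0"
  shows "bij_betw (\<lambda>a. bucket m a t) {1..m} {1..m}"
proof -
  have "(\<lambda>a. bucket m a t) ` {1..m} = {1..m}"
  proof
    show "(\<lambda>a. bucket m a t) ` {1..m} \<subseteq> {1..m}" using bucket_in[OF assms] by blast
    show "{1..m} \<subseteq> (\<lambda>a. bucket m a t) ` {1..m}"
    proof
      fix b assume "b \<in> {1..m}"
      \<comment> \<open>Rotations commute: if \<open>i\<close> steps lead from
        \<open>bucket m 1 t\<close> to \<open>b\<close>, then \<open>bucket m 1 i\<close> is a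
        preimage of \<open>b\<close>. Injectivity then follows by finiteness.\<close>
      then obtain i where "bucket m (bucket m 1 t) i = b"
        using bucket_surj[OF bucket_in[OF assms]] by blast
      hence "bucket m (bucket m 1 i) t = b" by (simp add: bucket_bucket add.commute)
      thus "b \<in> (\<lambda>a. bucket m a t) ` {1..m}" using bucket_in[OF assms] by blast
    qed
  qed
  thus ?thesis by (simp add: bij_betw_def eq_card_imp_inj_on)
qed

text \<open>Makes \<open>m\<close> the reference bucket of the averaging argument: every bucket is
  one of its rotations.\<close>

lemma bucket_last:
  assumes "e \<in> {1..m}"
  shows "bucket m m e = e"
proof -
  have "m - 1 + e = (e - 1) + m" using assms by auto
  hence "bucket m m e = (e - 1) mod m + 1" by (simp add: bucket_def)
  also have "(e - 1) mod m = e - 1" using assms by (intro mod_less) auto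
  finally show ?thesis using assms by simp
qed

definition landing :: "nat \<Rightarrow> nat set \<Rightarrow> nat \<Rightarrow> nat" where
  "landing m S a = bucket m a (probe m S a)"

lemma occupied_Suc: "occupied m h (Suc k) = insert (landing m (occupied m h k) (h (Suc k))) (occupied m h k)"
  by (simp add: landing_def Let_def)

lemma occupied_cong:
  "(\<And>x. x \<in> {1..k} \<Longrightarrow> h x = g x) \<Longrightarrow> occupied m h k = occupied m g k"
  by (induction k) (auto simp: occupied_Suc simp del: occupied.simps(2))

lemma displacement_cong:
  assumes "\<And>y. y \<in> {1..x} \<Longrightarrow> h y = g y" "x \<ge> 1"
  shows "displacement m h x = displacement m g x"
proof -
  have "occupied m h (x - 1) = occupied m g (x - 1)" using assms by (intro occupied_cong) auto
  thus ?thesis using assms by (simp add: displacement_def)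
qed

lemma occupied_subset: "m > 0 \<Longrightarrow> occupied m h k \<subseteq> {1..m}"
  by (induction k) (auto simp: occupied_Suc landing_def bucket_in[simplified] simp del: occupied.simps(2))

lemma landing_in: "m > 0 \<Longrightarrow> landing m S a \<in> {1..m}"
  unfolding landing_def by (rule bucket_in)

text \<open>\<open>probe\<close> is a least index and needs a witness: a free bucket exists by
  cardinality, and probing from \<open>a\<close> reaches every bucket.\<close>

lemma landing_notin:
  assumes "S \<subseteq> {1..m}" "card S < m" "a \<in> {1..m}"
  shows "landing m S a \<notin> S"
proof -
  have "S \<noteq> {1..m}" using assms(2) by auto
  then obtain b where "b \<in> {1..m}" "b \<notin> S" using assms(1) by blast
  then obtain i where "bucket m a i \<notin> S" using bucket_surj[OF assms(3)] by metis
  thus ?thesis unfolding landing_def probe_def by (rule LeastI)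
qed

lemma card_occupied:
  assumes "h \<in> {1..k} \<rightarrow> {1..m}" "k \<le> m"
  shows "card (occupied m h k) = k"
  using assms
proof (induction k)
  case (Suc k)
  have "h \<in> {1..k} \<rightarrow> {1..m}" using Suc.prems(1) by auto
  hence IH: "card (occupied m h k) = k" using Suc by simp
  have sub: "occupied m h k \<subseteq> {1..m}" using occupied_subset Suc.prems by auto
  have "h (Suc k) \<in> {1..m}" using Suc.prems by auto
  with landing_notin[OF sub] IH Suc.prems
  have "landing m (occupied m h k) (h (Suc k)) \<notin> occupied m h k" by simp
  thus ?case using IH sub finite_subset[OF sub] by (simp add: occupied_Suc del: occupied.simps(2))
qed simp

lemma probe_image:
  assumes "m > 0" "S \<subseteq> {1..m}"
  shows "probe m ((\<lambda>a. bucket m a t) ` S) (bucket m a t) = probe m S a"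
proof -
  have inj: "inj_on (\<lambda>a. bucket m a t) {1..m}" using bij_betw_bucket[OF assms(1)] by (simp add: bij_betw_def)
  have "bucket m (bucket m a t) i = bucket m (bucket m a i) t" for i
    by (simp add: bucket_bucket add.commute)
  hence "bucket m (bucket m a t) i \<in> (\<lambda>a. bucket m a t) ` S \<longleftrightarrow> bucket m a i \<in> S" for i
    using inj_on_image_mem_iff[OF inj bucket_in[OF assms(1)] assms(2)] by simp
  thus ?thesis by (simp add: probe_def)
qed

lemma landing_image:
  assumes "m > 0" "S \<subseteq> {1..m}"
  shows "landing m ((\<lambda>a. bucket m a t) ` S) (bucket m a t) = bucket m (landing m S a) t"
  unfolding landing_def probe_image[OF assms] by (simp add: bucket_bucket add.commute)

text \<open>Each single insertion commutes with rotation. The bound \<open>k \<le> n\<close> keeps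
  the inserted keys inside the domain of the rotated hash function.\<close>

lemma occupied_rotate:
  assumes "m > 0" "k \<le> n"
  shows "occupied m (\<lambda>x\<in>{1..n}. bucket m (h x) t) k = (\<lambda>a. bucket m a t) ` occupied m h k"
  using assms(2)
proof (induction k)
  case (Suc k)
  thus ?case
    using landing_image[OF assms(1) occupied_subset[OF assms(1)]]
    by (simp add: occupied_Suc del: occupied.simps(2))
qed simp

lemma displacement_rotate:
  assumes "m > 0" "x \<in> {1..n}"
  shows "displacement m (\<lambda>x\<in>{1..n}. bucket m (h x) t) x = displacement m h x"
proof -
  have "x - 1 \<le> n" using assms by auto
  thus ?thesis
    using assms probe_image[OF assms(1) occupied_subset[OF assms(1)]]
    by (simp add: displacement_def occupied_rotate)
qed

section \<open>Averaging over rotations\<close>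

lemma finite_hash_functions [simp]: "finite (hash_functions m k)"
  by (intro finite_PiE) auto

lemma card_hash_functions: "card (hash_functions m k) = m ^ k"
  by (simp add: card_PiE)

lemma sum_hash_functions_rotate:
  assumes "m > 0"
  shows "(\<Sum>h\<in>hash_functions m k. F (\<lambda>x\<in>{1..k}. bucket m (h x) t)) = (\<Sum>h\<in>hash_functions m k. F h)"
proof -
  let ?r = "\<lambda>h. \<lambda>x\<in>{1..k}. bucket m (h x) t"
  have inj: "inj_on (\<lambda>a. bucket m a t) {1..m}" using bij_betw_bucket[OF assms] by (simp add: bij_betw_def)
  \<comment> \<open>An injective map of the finite set of hash functions into itself permutes it, so
    the sum is only reindexed.\<close>
  have "inj_on ?r (hash_functions m k)"
  proof (rule inj_onI)
    fix h g assume hg: "h \<in> hash_functions m k" "g \<in> hash_functions m k" "?r h = ?r g"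
    show "h = g"
    proof (rule PiE_ext[OF hg(1,2)])
      fix x assume x: "x \<in> {1..k}"
      have "bucket m (h x) t = bucket m (g x) t" using fun_cong[OF hg(3), of x] x by simp
      thus "h x = g x" using inj_onD[OF inj] PiE_mem[OF hg(1) x] PiE_mem[OF hg(2) x] by blast
    qed
  qed
  moreover have "?r ` hash_functions m k \<subseteq> hash_functions m k"
    using bucket_in[OF assms] by (auto simp del: atLeastAtMost_iff)
  ultimately have "bij_betw ?r (hash_functions m k) (hash_functions m k)"
    unfolding bij_betw_def using endo_inj_surj[OF finite_hash_functions] by blast
  thus ?thesis by (rule sum.reindex_bij_betw)
qed

text \<open>Rotation by \<open>e\<close> carries the situation at bucket \<open>m\<close> to that at
  \<open>e\<close> and permutes the hash functions, so all \<open>e\<close> contribute alike. It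
  serves with \<open>\<Psi>\<close> marking an empty bucket or the bucket that the last key
  fills.\<close>

lemma sum_rotation_invariant:
  fixes \<Psi> :: "(nat \<Rightarrow> nat) \<Rightarrow> nat \<Rightarrow> 'b :: comm_semiring_1"
  assumes "m > 0"
    and inv: "\<And>h e t. h \<in> hash_functions m k \<Longrightarrow> e \<in> {1..m} \<Longrightarrow>
      \<Psi> (\<lambda>x\<in>{1..k}. bucket m (h x) t) (bucket m e t) = \<Psi> h e"
  shows "(\<Sum>h\<in>hash_functions m k. \<Sum>e=1..m. \<Psi> h e) = of_nat m * (\<Sum>h\<in>hash_functions m k. \<Psi> h m)"
proof -
  have "(\<Sum>h\<in>hash_functions m k. \<Psi> h e) = (\<Sum>h\<in>hash_functions m k. \<Psi> h m)" if e: "e \<in> {1..m}" for e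
  proof -
    have "(\<Sum>h\<in>hash_functions m k. \<Psi> h m) =
      (\<Sum>h\<in>hash_functions m k. \<Psi> (\<lambda>x\<in>{1..k}. bucket m (h x) e) (bucket m m e))"
      using assms(1) by (intro sum.cong refl inv[symmetric]) auto
    also have "\<dots> = (\<Sum>h\<in>hash_functions m k. \<Psi> h e)"
      unfolding bucket_last[OF e] by (rule sum_hash_functions_rotate[OF assms(1)])
    finally show ?thesis by simp
  qed
  hence "(\<Sum>e=1..m. \<Sum>h\<in>hash_functions m k. \<Psi> h e) = (\<Sum>e=1..m. \<Sum>h\<in>hash_functions m k. \<Psi> h m)"
    by (rule sum.cong[OF refl])
  thus ?thesis by (subst sum.swap) simp
qed

lemma bucket_in_rotate_iff:
  assumes "m > 0" "S \<subseteq> {1..m}" "e \<in> {1..m}"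
  shows "bucket m e t \<in> (\<lambda>a. bucket m a t) ` S \<longleftrightarrow> e \<in> S"
  using bij_betw_bucket[OF assms(1)] assms
  by (intro inj_on_image_mem_iff[where B = "{1..m}"]) (auto simp: bij_betw_def)

definition last_empty :: "nat \<Rightarrow> nat \<Rightarrow> nat" where
  "last_empty m k = card {h \<in> hash_functions m k. m \<notin> occupied m h k}"

text \<open>Counts pairs of a hash function and an empty bucket in two ways: every table has
  \<open>m - k\<close> empty buckets, and by rotation each bucket is empty equally often. The factor
  \<open>m\<close> avoids the exponent \<open>k - 1\<close>, which would truncate at
  \<open>k = 0\<close>.\<close>

lemma mult_last_empty:
  assumes "k \<le> m" "m > 0"
  shows "m * last_empty m k = (m - k) * m ^ k"
proof -
  let ?\<Psi> = "\<lambda>h e. if e \<notin> occupied m h k then 1 else 0 :: nat"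
  have "(\<Sum>h\<in>hash_functions m k. \<Sum>e=1..m. ?\<Psi> h e) = of_nat m * (\<Sum>h\<in>hash_functions m k. ?\<Psi> h m)"
    using occupied_rotate[OF assms(2) order_refl]
      bucket_in_rotate_iff[OF assms(2) occupied_subset[OF assms(2)]]
    by (intro sum_rotation_invariant assms(2)) simp
  also have "(\<Sum>h\<in>hash_functions m k. ?\<Psi> h m) = last_empty m k"
    by (simp add: last_empty_def sum.If_cases Int_def)
  also have "(\<Sum>h\<in>hash_functions m k. \<Sum>e=1..m. ?\<Psi> h e) = (\<Sum>h\<in>hash_functions m k. m - k)"
  proof (rule sum.cong)
    fix h assume h: "h \<in> hash_functions m k"
    have "(\<Sum>e=1..m. ?\<Psi> h e) = card ({1..m} - occupied m h k)"
      by (simp add: sum.If_cases Diff_eq Compl_eq)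
    also have "\<dots> = m - k"
      using h assms occupied_subset[OF assms(2)] finite_subset[OF occupied_subset[OF assms(2)]]
      by (subst card_Diff_subset) (simp_all add: card_occupied PiE_iff Pi_iff)
    finally show "(\<Sum>e=1..m. ?\<Psi> h e) = m - k" .
  qed simp
  finally show ?thesis by (simp add: card_hash_functions mult.commute)
qed

lemma sum_hash_functions_Suc:
  "(\<Sum>h\<in>hash_functions m (Suc k). F h) = (\<Sum>g\<in>hash_functions m k. \<Sum>a=1..m. F (g(Suc k := a)))"
proof -
  have ins: "{1..Suc k} = insert (Suc k) {1..k}" by auto
  have inj: "inj_on (\<lambda>(y, g). g(Suc k := y)) ({1..m} \<times> hash_functions m k)"
    using inj_combinator[of "Suc k" "{1..k}" "\<lambda>_. {1..m}"] by simp
  have "(\<Sum>h\<in>hash_functions m (Suc k). F h) =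
    (\<Sum>h\<in>(\<lambda>(y, g). g(Suc k := y)) ` ({1..m} \<times> hash_functions m k). F h)"
    unfolding ins PiE_insert_eq ..
  also have "\<dots> = (\<Sum>(y, g)\<in>{1..m} \<times> hash_functions m k. F (g(Suc k := y)))"
    unfolding sum.reindex[OF inj] by (intro sum.cong) auto
  also have "\<dots> = (\<Sum>a=1..m. \<Sum>g\<in>hash_functions m k. F (g(Suc k := a)))"
    by (rule sum.cartesian_product[symmetric])
  also have "\<dots> = (\<Sum>g\<in>hash_functions m k. \<Sum>a=1..m. F (g(Suc k := a)))"
    by (rule sum.swap)
  finally show ?thesis .
qed

subsection \<open>Counting the insertions that fill a given set of buckets\<close>

text \<open>While bucket \<open>m\<close> is empty no key passes it, so cyclic probing never wraps
  around and becomes a search along an interval of integers.\<close>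

lemma landing_eq_iff:
  assumes "m \<notin> S" "a \<in> {1..m}" "e \<in> {1..m}"
  shows "landing m S a = e \<longleftrightarrow> a \<le> e \<and> e \<notin> S \<and> {a..<e} \<subseteq> S"
    and "landing m S a = e \<Longrightarrow> probe m S a = e - a"
proof -
  have b: "bucket m a i = a + i" if "a + i \<le> m" for i
  proof -
    have "a - 1 + i < m" "a - 1 + i + 1 = a + i" using that assms by auto
    thus ?thesis by (simp add: bucket_def)
  qed
  have pr: "probe m S a = d" if "a + d \<le> m" "a + d \<notin> S" "{a..<a + d} \<subseteq> S" for d
    unfolding probe_def
  proof (rule Least_equality)
    show "bucket m a d \<notin> S" using b that by simp
    fix i assume i: "bucket m a i \<notin> S"
    show "d \<le> i"
    proof (rule ccontr)
      assume "\<not> d \<le> i"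
      hence "bucket m a i = a + i" "a + i \<in> {a..<a + d}" using b that by auto
      thus False using i subsetD[OF that(3)] by metis
    qed
  qed
  \<comment> \<open>The empty bucket \<open>m\<close> itself bounds the search.\<close>
  have "\<exists>d. a + d \<notin> S" using assms by (intro exI[of _ "m - a"]) auto
  hence ex: "a + (LEAST d. a + d \<notin> S) \<notin> S" by (rule LeastI_ex)
  define d where "d = (LEAST d. a + d \<notin> S)"
  have "d \<le> m - a" unfolding d_def using assms by (intro Least_le) auto
  hence dm: "a + d \<le> m" using assms by auto
  have dS: "{a..<a + d} \<subseteq> S"
  proof
    fix x assume x: "x \<in> {a..<a + d}"
    hence "x - a < d" by auto
    hence "a + (x - a) \<in> S" unfolding d_def using not_less_Least by blast
    thus "x \<in> S" using x by simp
  qed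
  have p: "probe m S a = d" using pr dm dS ex unfolding d_def by blast
  have l: "landing m S a = a + d" using b dm p by (simp add: landing_def)
  show "landing m S a = e \<longleftrightarrow> a \<le> e \<and> e \<notin> S \<and> {a..<e} \<subseteq> S"
  proof
    assume "landing m S a = e"
    thus "a \<le> e \<and> e \<notin> S \<and> {a..<e} \<subseteq> S" using l dS ex unfolding d_def by auto
  next
    assume e: "a \<le> e \<and> e \<notin> S \<and> {a..<e} \<subseteq> S"
    hence "probe m S a = e - a" using assms by (intro pr) auto
    thus "landing m S a = e" using l p e by simp
  qed
  show "probe m S a = e - a" if "landing m S a = e" using that l p by simp
qed

text \<open>For \<open>e\<close> in \<open>S\<close>, with bucket \<open>m\<close> outside
  \<open>S\<close>, this is the number of hash addresses from which a key reaches \<open>e\<close>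
  when exactly the rest of \<open>S\<close> is full.\<close>

definition run_length :: "nat set \<Rightarrow> nat \<Rightarrow> nat" where
  "run_length S e = card {a. a \<le> e \<and> {a..e} \<subseteq> S}"

text \<open>The last key fills some bucket \<open>e\<close> of \<open>S\<close>, and its address is in the run of \<open>S\<close> that ends at \<open>e\<close>.\<close>

fun fillings :: "nat \<Rightarrow> nat set \<Rightarrow> nat" where
  "fillings 0 S = (if S = {} then 1 else 0)"
| "fillings (Suc k) S = (\<Sum>e\<in>S. fillings k (S - {e}) * run_length S e)"

text \<open>The recursion removes one bucket per key, so it ends at the empty set only if the sizes
  agree.\<close>

lemma fillings_eq_0: "finite S \<Longrightarrow> card S \<noteq> k \<Longrightarrow> fillings k S = 0"
proof (induction k arbitrary: S)
  case (Suc k)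
  have "fillings k (S - {e}) = 0" if "e \<in> S" for e
    using card_Suc_Diff1[OF Suc.prems(1) that] Suc.prems by (intro Suc.IH) auto
  thus ?case by simp
qed auto

lemma sum_card_eq:
  "finite A \<Longrightarrow> (\<Sum>x\<in>A. if P x then 1 else 0) = card {x \<in> A. P x}"
  by (simp add: sum.If_cases Int_def)

lemma card_landing:
  assumes "S \<subseteq> {1..<m}" "e \<in> S"
  shows "card {a \<in> {1..m}. landing m (S - {e}) a = e} = run_length S e"
proof -
  have e: "e \<in> {1..m}" "m \<notin> S - {e}" using assms by auto
  have "landing m (S - {e}) a = e \<longleftrightarrow> a \<le> e \<and> {a..e} \<subseteq> S" if "a \<in> {1..m}" for a
  proof -
    have "{a..e} = insert e {a..<e}" if "a \<le> e" using that by auto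
    thus ?thesis unfolding landing_eq_iff(1)[OF e(2) that e(1)] using assms(2) by auto
  qed
  moreover have "a \<in> {1..m}" if "a \<le> e" "{a..e} \<subseteq> S" for a
  proof -
    have "a \<in> S" using that by auto
    thus ?thesis using assms(1) by auto
  qed
  ultimately have "{a \<in> {1..m}. landing m (S - {e}) a = e} = {a. a \<le> e \<and> {a..e} \<subseteq> S}"
    by blast
  thus ?thesis by (simp add: run_length_def)
qed

lemma occupied_fun_upd: "occupied m (g(Suc k := a)) k = occupied m g k"
  by (rule occupied_cong) auto

text \<open>Justifies the recursion of \<open>fillings\<close> by splitting the hash functions
  according to the bucket \<open>e\<close> that the last key fills. As bucket \<open>m\<close> stays
  empty, the count does not depend on \<open>m\<close>.\<close>

lemma card_occupied_eq:
  assumes "S \<subseteq> {1..<m}" "k < m"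
  shows "card {h \<in> hash_functions m k. occupied m h k = S} = fillings k S"
  using assms
proof (induction k arbitrary: S)
  case 0
  have "{h \<in> hash_functions m 0. occupied m h 0 = S} = (if S = {} then {\<lambda>_. undefined} else {})" by auto
  thus ?case by simp
next
  case (Suc k)
  have fin: "finite S" using Suc.prems finite_subset by blast
  \<comment> \<open>Only the bucket where the last key lands can contribute on the right. As that
    bucket is new, removing it from \<open>S\<close> gives the old set exactly when inserting it
    gives \<open>S\<close>.\<close>
  have step: "(if occupied m (g(Suc k := a)) (Suc k) = S then 1 else 0) =
      (\<Sum>e\<in>S. (if occupied m g k = S - {e} then 1 else 0) *
        (if landing m (S - {e}) a = e then 1 else 0 :: nat))" (is "?l = ?r")
    if g: "g \<in> hash_functions m k" and a: "a \<in> {1..m}" for g a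
  proof -
    let ?O = "occupied m g k" and ?e = "landing m (occupied m g k) a"
    have "?O \<subseteq> {1..m}" using Suc.prems by (intro occupied_subset) auto
    moreover have "card ?O = k" using g Suc.prems by (intro card_occupied) (auto simp: PiE_iff)
    ultimately have new: "?e \<notin> ?O" using a Suc.prems by (intro landing_notin) auto
    have "(if ?O = S - {e} then 1 else 0) * (if landing m (S - {e}) a = e then 1 else 0) =
        (if ?e = e then (if ?O = S - {?e} then 1 else 0) else 0 :: nat)" for e
      by (cases "?O = S - {e}"; cases "?e = e") simp_all
    hence "?r = (\<Sum>e\<in>S. if ?e = e then (if ?O = S - {?e} then 1 else 0) else 0)" by simp
    also have "\<dots> = (if ?e \<in> S \<and> ?O = S - {?e} then 1 else 0)"
      using fin by (simp add: sum.delta)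
    also have "?e \<in> S \<and> ?O = S - {?e} \<longleftrightarrow> insert ?e ?O = S" using new by blast
    finally show ?thesis by (simp add: occupied_Suc occupied_fun_upd del: occupied.simps(2))
  qed
  have "card {h \<in> hash_functions m (Suc k). occupied m h (Suc k) = S} =
    (\<Sum>h\<in>hash_functions m (Suc k). if occupied m h (Suc k) = S then 1 else 0)"
    by (simp add: sum_card_eq del: occupied.simps(2))
  also have "\<dots> = (\<Sum>g\<in>hash_functions m k. \<Sum>a=1..m. \<Sum>e\<in>S.
      (if occupied m g k = S - {e} then 1 else 0) * (if landing m (S - {e}) a = e then 1 else 0))"
    unfolding sum_hash_functions_Suc by (intro sum.cong refl step)
  also have "\<dots> = (\<Sum>g\<in>hash_functions m k. \<Sum>e\<in>S. \<Sum>a=1..m.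
      (if occupied m g k = S - {e} then 1 else 0) * (if landing m (S - {e}) a = e then 1 else 0))"
    by (rule sum.cong[OF refl sum.swap])
  also have "\<dots> = (\<Sum>e\<in>S. \<Sum>g\<in>hash_functions m k. \<Sum>a=1..m.
      (if occupied m g k = S - {e} then 1 else 0) * (if landing m (S - {e}) a = e then 1 else 0))"
    by (rule sum.swap)
  also have "\<dots> = (\<Sum>e\<in>S. (\<Sum>g\<in>hash_functions m k. if occupied m g k = S - {e} then 1 else 0) *
      (\<Sum>a=1..m. if landing m (S - {e}) a = e then 1 else 0))"
    by (simp only: sum_product)
  also have "\<dots> = (\<Sum>e\<in>S. fillings k (S - {e}) * run_length S e)"
  proof (intro sum.cong refl arg_cong2[where f = "(*)"])
    fix e assume e: "e \<in> S"
    have "S - {e} \<subseteq> {1..<m}" "k < m" using Suc.prems by auto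
    thus "(\<Sum>g\<in>hash_functions m k. if occupied m g k = S - {e} then 1 else 0) = fillings k (S - {e})"
      by (simp add: sum_card_eq Suc.IH)
    show "(\<Sum>a=1..m. if landing m (S - {e}) a = e then 1 else 0) = run_length S e"
      unfolding card_landing[OF Suc.prems(1) e, symmetric] by (rule sum_card_eq) simp
  qed
  finally show ?case by simp
qed

text \<open>Runs are translated together with the set, so the recursion sees no difference.\<close>

lemma fillings_shift: "fillings k ((+) t ` S) = fillings k S"
proof (induction k arbitrary: S)
  case (Suc k)
  have "run_length ((+) t ` S) (t + e) = run_length S e" for e
  proof -
    have "{a. a \<le> t + e \<and> {a..t + e} \<subseteq> (+) t ` S} = (+) t ` {a. a \<le> e \<and> {a..e} \<subseteq> S}"
    proof (intro equalityI subsetI)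
      fix a assume a: "a \<in> {a. a \<le> t + e \<and> {a..t + e} \<subseteq> (+) t ` S}"
      hence "a \<in> (+) t ` S" by auto
      then obtain b where b: "a = t + b" by auto
      have "{b..e} \<subseteq> S"
      proof
        fix x assume "x \<in> {b..e}"
        hence "t + x \<in> (+) t ` S" using a b by auto
        thus "x \<in> S" by auto
      qed
      thus "a \<in> (+) t ` {a. a \<le> e \<and> {a..e} \<subseteq> S}" using a b by auto
    next
      fix a assume "a \<in> (+) t ` {a. a \<le> e \<and> {a..e} \<subseteq> S}"
      then obtain b where b: "a = t + b" "b \<le> e" "{b..e} \<subseteq> S" by auto
      have "{a..t + e} = (+) t ` {b..e}" using b(1) by (simp add: image_add_atLeastAtMost)
      also have "\<dots> \<subseteq> (+) t ` S" using b(3) by (rule image_mono)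
      finally show "a \<in> {a. a \<le> t + e \<and> {a..t + e} \<subseteq> (+) t ` S}" using b(1,2) by simp
    qed
    thus ?thesis by (simp add: run_length_def card_image)
  qed
  moreover have "(+) t ` S - {t + e} = (+) t ` (S - {e})" for e by auto
  ultimately show ?case by (simp add: sum.reindex Suc.IH)
qed simp

text \<open>The gap \<open>p\<close> lies in neither set, so no run crosses it.\<close>

lemma run_length_Un:
  assumes "\<And>a. a \<in> A \<Longrightarrow> a < p" "\<And>b. b \<in> B \<Longrightarrow> p < b"
  shows "e \<in> A \<Longrightarrow> run_length (A \<union> B) e = run_length A e"
    and "e \<in> B \<Longrightarrow> run_length (A \<union> B) e = run_length B e"
proof -
  assume e: "e \<in> A"
  have "{a..e} \<subseteq> A \<union> B \<longleftrightarrow> {a..e} \<subseteq> A" if "a \<le> e" for a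
    using assms(1)[OF e] assms(2) by fastforce
  thus "run_length (A \<union> B) e = run_length A e"
    unfolding run_length_def by (simp cong: conj_cong)
next
  assume e: "e \<in> B"
  have "{a..e} \<subseteq> A \<union> B \<longleftrightarrow> {a..e} \<subseteq> B" if "a \<le> e" for a
  proof
    assume sub: "{a..e} \<subseteq> A \<union> B"
    have "p \<notin> A \<union> B" using assms by blast
    hence "\<not> a \<le> p" using subsetD[OF sub, of p] assms(2)[OF e] by auto
    thus "{a..e} \<subseteq> B" using subsetD[OF sub] assms(1) by fastforce
  qed auto
  thus "run_length (A \<union> B) e = run_length B e"
    unfolding run_length_def by (simp cong: conj_cong)
qed

text \<open>The gap \<open>p\<close> makes the fillings of the two sides independent; the binomial
  coefficient chooses the keys that go to \<open>B\<close>. Splitting by the side of the last key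
  turns the induction into Pascal's rule.\<close>

lemma fillings_Un:
  assumes "finite A" "finite B" "\<And>a. a \<in> A \<Longrightarrow> a < p" "\<And>b. b \<in> B \<Longrightarrow> p < b"
    and "card A + card B = k"
  shows "fillings k (A \<union> B) = (k choose card B) * fillings (card A) A * fillings (card B) B"
  using assms
proof (induction k arbitrary: A B)
  case (Suc k)
  have disj: "A \<inter> B = {}" using Suc.prems(3,4) by fastforce
  have run: "e \<in> A \<Longrightarrow> run_length (A \<union> B) e = run_length A e"
    "e \<in> B \<Longrightarrow> run_length (A \<union> B) e = run_length B e" for e
    using run_length_Un[of A p B e] Suc.prems(3,4) by blast+
  have "(\<Sum>e\<in>A. fillings k (A \<union> B - {e}) * run_length (A \<union> B) e) =
      (k choose card B) * fillings (card A) A * fillings (card B) B"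
  proof (cases "card A")
    \<comment> \<open>If \<open>A\<close> is empty, then \<open>card B = Suc k\<close> and the
      binomial coefficient is zero.\<close>
    case 0
    thus ?thesis using Suc.prems by auto
  next
    case (Suc i)
    have "fillings k (A \<union> B - {e}) * run_length (A \<union> B) e =
        (k choose card B) * fillings (card B) B * (fillings i (A - {e}) * run_length A e)"
      if e: "e \<in> A" for e
    proof -
      have c: "card (A - {e}) = i" using e Suc by simp
      have "fillings k ((A - {e}) \<union> B) = (k choose card B) * fillings (card (A - {e})) (A - {e}) * fillings (card B) B"
        using Suc.prems Suc c by (intro Suc.IH) auto
      moreover have "A \<union> B - {e} = (A - {e}) \<union> B" using disj e by auto
      ultimately show ?thesis using c run(1)[OF e] by (simp add: mult_ac)
    qed
    hence "(\<Sum>e\<in>A. fillings k (A \<union> B - {e}) * run_length (A \<union> B) e) =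
        (\<Sum>e\<in>A. (k choose card B) * fillings (card B) B * (fillings i (A - {e}) * run_length A e))"
      by (rule sum.cong[OF refl])
    thus ?thesis unfolding Suc by (simp flip: sum_distrib_left)
  qed
  \<comment> \<open>The case distinction guards against the truncation of \<open>card B - 1\<close>
    at 0, where Pascal's rule has no second term.\<close>
  moreover have "(\<Sum>e\<in>B. fillings k (A \<union> B - {e}) * run_length (A \<union> B) e) =
      (if card B = 0 then 0 else (k choose (card B - 1))) * fillings (card A) A * fillings (card B) B"
  proof (cases "card B")
    case 0
    thus ?thesis using Suc.prems by auto
  next
    case (Suc i)
    have "fillings k (A \<union> B - {e}) * run_length (A \<union> B) e =
        (k choose i) * fillings (card A) A * (fillings i (B - {e}) * run_length B e)"
      if e: "e \<in> B" for e
    proof -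
      have c: "card (B - {e}) = i" using e Suc by simp
      have "fillings k (A \<union> (B - {e})) = (k choose card (B - {e})) * fillings (card A) A * fillings (card (B - {e})) (B - {e})"
        using Suc.prems Suc c by (intro Suc.IH) auto
      moreover have "A \<union> B - {e} = A \<union> (B - {e})" using disj e by auto
      ultimately show ?thesis using c run(2)[OF e] by (simp add: mult_ac)
    qed
    hence "(\<Sum>e\<in>B. fillings k (A \<union> B - {e}) * run_length (A \<union> B) e) =
        (\<Sum>e\<in>B. (k choose i) * fillings (card A) A * (fillings i (B - {e}) * run_length B e))"
      by (rule sum.cong[OF refl])
    thus ?thesis unfolding Suc by (simp flip: sum_distrib_left)
  qed
  moreover have "(Suc k choose card B) = (k choose card B) + (if card B = 0 then 0 else (k choose (card B - 1)))"
    by (cases "card B") auto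
  ultimately show ?case
    using Suc.prems(1,2) disj by (simp add: sum.union_disjoint algebra_simps)
qed auto

subsection \<open>Displacement of a single key\<close>

text \<open>Groups the hash functions by their set of occupied buckets, so that later sums run over
  sets weighted by \<open>fillings\<close>.\<close>

lemma sum_occupied:
  fixes F :: "nat set \<Rightarrow> 'b :: comm_semiring_1"
  assumes "k < m"
  shows "(\<Sum>h\<in>{h \<in> hash_functions m k. m \<notin> occupied m h k}. F (occupied m h k)) =
    (\<Sum>S\<in>Pow {1..<m}. of_nat (fillings k S) * F S)"
proof -
  let ?H = "{h \<in> hash_functions m k. m \<notin> occupied m h k}"
  have "(\<lambda>h. occupied m h k) ` ?H \<subseteq> Pow {1..<m}"
  proof clarsimp
    fix h a assume "m \<notin> occupied m h k" "a \<in> occupied m h k"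
    thus "1 \<le> a \<and> a < m"
      using subsetD[OF occupied_subset[of m h k], of a] assms by (cases "a = m") auto
  qed
  hence "(\<Sum>h\<in>?H. F (occupied m h k)) =
      (\<Sum>S\<in>Pow {1..<m}. \<Sum>h\<in>{h \<in> ?H. occupied m h k = S}. F (occupied m h k))"
    by (intro sum.group[symmetric]) auto
  also have "\<dots> = (\<Sum>S\<in>Pow {1..<m}. of_nat (fillings k S) * F S)"
  proof (rule sum.cong[OF refl])
    fix S assume S: "S \<in> Pow {1..<m}"
    hence "{h \<in> ?H. occupied m h k = S} = {h \<in> hash_functions m k. occupied m h k = S}" by auto
    moreover have "card {h \<in> hash_functions m k. occupied m h k = S} = fillings k S"
      using S assms by (intro card_occupied_eq) auto
    ultimately show "(\<Sum>h\<in>{h \<in> ?H. occupied m h k = S}. F (occupied m h k)) = of_nat (fillings k S) * F S"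
      by simp
  qed
  finally show ?thesis .
qed

lemma last_empty_eq_sum_fillings: "k < m \<Longrightarrow> last_empty m k = (\<Sum>S\<in>Pow {1..<m}. fillings k S)"
  using sum_occupied[of k m "\<lambda>_. 1 :: nat"] by (simp add: last_empty_def)

text \<open>The number of parking functions of \<open>l\<close> cars. At \<open>l = 0\<close> the
  exponent truncates to 0, and the value 1 is still right.\<close>

lemma last_empty_full: "last_empty (Suc l) l = Suc l ^ (l - 1)"
proof -
  have "Suc l * last_empty (Suc l) l = Suc l ^ l" using mult_last_empty[of l "Suc l"] by simp
  also have "\<dots> = Suc l * Suc l ^ (l - 1)" by (cases l) simp_all
  finally show ?thesis by (simp only: mult_cancel1) simp
qed

text \<open>\<open>{1..<Suc l}\<close> is its only subset with \<open>l\<close> elements, so the sum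
  over all occupied sets collapses to one term; translation does the rest.\<close>

lemma fillings_interval: "fillings l {p<..<Suc (p + l)} = Suc l ^ (l - 1)"
proof -
  have "fillings l S = 0" if "S \<in> Pow {1..<Suc l}" "S \<noteq> {1..<Suc l}" for S
  proof (rule fillings_eq_0)
    show "finite S" using that finite_subset by auto
    have "card S < card {1..<Suc l}" using that by (intro psubset_card_mono) auto
    thus "card S \<noteq> l" by simp
  qed
  hence "(\<Sum>S\<in>Pow {1..<Suc l}. fillings l S) = (\<Sum>S\<in>{{1..<Suc l}}. fillings l S)"
    by (intro sum.mono_neutral_right) auto
  hence "fillings l {1..<Suc l} = Suc l ^ (l - 1)"
    using last_empty_eq_sum_fillings[of l "Suc l"] by (simp add: last_empty_full)
  moreover have "{p<..<Suc (p + l)} = (+) p ` {1..<Suc l}"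
    by (auto simp: image_add_atLeastLessThan)
  ultimately show ?thesis by (simp only: fillings_shift)
qed

text \<open>\<open>p\<close> is the last gap before \<open>m\<close>, so the key reaches
  \<open>m\<close> precisely from the addresses \<open>p + 1\<close> to \<open>m\<close>, one for
  each displacement below \<open>m - p\<close>.\<close>

lemma sum_landing_last:
  fixes q :: "'b :: comm_semiring_1"
  assumes "p \<in> {1..<m}" "A \<subseteq> {1..<p}"
  shows "(\<Sum>a=1..m. if landing m (A \<union> {p<..<m}) a = m then q ^ probe m (A \<union> {p<..<m}) a else 0) =
    (\<Sum>d<m - p. q ^ d)"
proof -
  let ?S = "A \<union> {p<..<m}"
  have m: "m \<notin> ?S" "m \<in> {1..m}" and p: "p \<notin> ?S" using assms by auto
  have "landing m ?S a = m \<longleftrightarrow> p < a" if "a \<in> {1..m}" for a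
  proof -
    have "{a..<m} \<subseteq> ?S \<longleftrightarrow> p < a"
    proof
      assume "{a..<m} \<subseteq> ?S"
      from subsetD[OF this, of p] show "p < a" using p assms(1) not_less[of p a] by auto
    qed auto
    thus ?thesis using that m by (simp only: landing_eq_iff(1)[OF m(1) that m(2)]) auto
  qed
  hence "(\<Sum>a=1..m. if landing m ?S a = m then q ^ probe m ?S a else 0) =
      (\<Sum>a=1..m. if p < a then q ^ (m - a) else 0)"
    using landing_eq_iff(2)[OF m(1) _ m(2)] by (intro sum.cong) auto
  also have "\<dots> = (\<Sum>a\<in>{a \<in> {1..m}. p < a}. q ^ (m - a))"
    by (simp add: sum.If_cases Int_def)
  also have "\<dots> = (\<Sum>d<m - p. q ^ d)"
    by (rule sum.reindex_bij_witness[of _ "\<lambda>d. m - d" "\<lambda>a. m - a"]) auto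
  finally show ?thesis .
qed

text \<open>Classifies the sets by their largest missing element \<open>p\<close>; the full set has
  none and must therefore contribute zero.\<close>

lemma sum_Pow_last_gap:
  fixes F :: "nat set \<Rightarrow> 'b :: comm_monoid_add"
  assumes "F {1..<m} = 0"
  shows "(\<Sum>S\<in>Pow {1..<m}. F S) = (\<Sum>p\<in>{1..<m}. \<Sum>A\<in>Pow {1..<p}. F (A \<union> {p<..<m}))"
proof -
  let ?P = "Pow {1..<m} - {{1..<m}}" and ?gap = "\<lambda>S. Max ({1..<m} - S)"
  have gap: "?gap S = p \<longleftrightarrow> p \<notin> S \<and> {p<..<m} \<subseteq> S" if "S \<in> ?P" "p \<in> {1..<m}" for S p
  proof -
    have "{1..<m} - S \<noteq> {}" using that by auto
    hence "?gap S = p \<longleftrightarrow> p \<in> {1..<m} - S \<and> (\<forall>a\<in>{1..<m} - S. a \<le> p)"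
      by (intro Max_eq_iff) auto
    also have "(\<forall>a\<in>{1..<m} - S. a \<le> p) \<longleftrightarrow> {p<..<m} \<subseteq> S"
      using that(2) by (auto simp: subset_iff not_le[symmetric])
    finally show ?thesis using that by blast
  qed
  have "(\<Sum>S\<in>Pow {1..<m}. F S) = (\<Sum>S\<in>?P. F S)"
    using assms by (intro sum.mono_neutral_right) auto
  also have "\<dots> = (\<Sum>p\<in>{1..<m}. \<Sum>S\<in>{S \<in> ?P. ?gap S = p}. F S)"
  proof (intro sum.group[symmetric] subsetI)
    fix p assume "p \<in> ?gap ` ?P"
    then obtain S where S: "S \<in> ?P" "p = ?gap S" by blast
    hence "{1..<m} - S \<noteq> {}" by auto
    hence "p \<in> {1..<m} - S" unfolding S(2) by (intro Max_in) auto
    thus "p \<in> {1..<m}" by blast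
  qed auto
  also have "\<dots> = (\<Sum>p\<in>{1..<m}. \<Sum>A\<in>Pow {1..<p}. F (A \<union> {p<..<m}))"
  proof (rule sum.cong[OF refl])
    fix p assume p: "p \<in> {1..<m}"
    have "{S \<in> ?P. ?gap S = p} = {S \<in> ?P. p \<notin> S \<and> {p<..<m} \<subseteq> S}" using gap p by blast
    also have "\<dots> = (\<lambda>A. A \<union> {p<..<m}) ` Pow {1..<p}"
    proof (intro equalityI subsetI)
      fix S assume S: "S \<in> {S \<in> ?P. p \<notin> S \<and> {p<..<m} \<subseteq> S}"
      have "S = (S \<inter> {1..<p}) \<union> {p<..<m}"
      proof (intro equalityI subsetI)
        fix x assume x: "x \<in> S"
        hence "x \<in> {1..<m}" "x \<noteq> p" using S by auto
        thus "x \<in> (S \<inter> {1..<p}) \<union> {p<..<m}" using x by auto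
      qed (use S in blast)
      thus "S \<in> (\<lambda>A. A \<union> {p<..<m}) ` Pow {1..<p}" by blast
    next
      fix S assume "S \<in> (\<lambda>A. A \<union> {p<..<m}) ` Pow {1..<p}"
      then obtain A where A: "A \<subseteq> {1..<p}" "S = A \<union> {p<..<m}" by blast
      hence "S \<subseteq> {1..<m}" "p \<notin> S" using p by auto
      thus "S \<in> {S \<in> ?P. p \<notin> S \<and> {p<..<m} \<subseteq> S}" using p A(2) by blast
    qed
    finally have eq: "{S \<in> ?P. ?gap S = p} = (\<lambda>A. A \<union> {p<..<m}) ` Pow {1..<p}" .
    have "inj_on (\<lambda>A. A \<union> {p<..<m}) (Pow {1..<p})"
    proof (rule inj_onI)
      fix A B assume AB: "A \<in> Pow {1..<p}" "B \<in> Pow {1..<p}" "A \<union> {p<..<m} = B \<union> {p<..<m}"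
      have "A = (A \<union> {p<..<m}) \<inter> {1..<p}" "B = (B \<union> {p<..<m}) \<inter> {1..<p}" using AB(1,2) by auto
      thus "A = B" using AB(3) by simp
    qed
    thus "(\<Sum>S\<in>{S \<in> ?P. ?gap S = p}. F S) = (\<Sum>A\<in>Pow {1..<p}. F (A \<union> {p<..<m}))"
      unfolding eq by (simp add: sum.reindex)
  qed
  finally show ?thesis .
qed

text \<open>Rotate the bucket filled by the last key to \<open>m\<close>, and let
  \<open>m - j\<close> be the last gap before it. Of the \<open>k\<close> earlier keys,
  \<open>j - 1\<close> fill the block in between, in \<open>j ^ (j - 2)\<close> ways, and the other
  \<open>Suc k - j\<close> go below the gap, as in a table of length \<open>m - j\<close> whose last
  bucket stays empty. The address of the last key yields the geometric sum.\<close>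

lemma sum_last_key_displacement:
  fixes q :: "'b :: comm_semiring_1"
  assumes "Suc k < m"
  shows "(\<Sum>h\<in>hash_functions m (Suc k). q ^ displacement m h (Suc k)) =
    of_nat m * (\<Sum>j\<in>{1..<m}. of_nat ((k choose (j - 1)) * j ^ (j - 2) * last_empty (m - j) (Suc k - j))
      * (\<Sum>d<j. q ^ d))"
proof -
  have m: "m > 0" using assms by simp
  define \<Psi> where "\<Psi> h e = (if landing m (occupied m h k) (h (Suc k)) = e
    then q ^ displacement m h (Suc k) else 0)" for h e
  define G where "G S = (\<Sum>a=1..m. if landing m S a = m then q ^ probe m S a else 0)" for S
  have "(\<Sum>h\<in>hash_functions m (Suc k). q ^ displacement m h (Suc k)) =
      (\<Sum>h\<in>hash_functions m (Suc k). \<Sum>e=1..m. \<Psi> h e)"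
    using landing_in[OF m] by (simp add: \<Psi>_def sum.delta')
  also have "\<dots> = of_nat m * (\<Sum>h\<in>hash_functions m (Suc k). \<Psi> h m)"
  proof (rule sum_rotation_invariant[OF m])
    fix h e t assume "h \<in> hash_functions m (Suc k)" and e: "e \<in> {1..m}"
    have "landing m (occupied m h k) (h (Suc k)) = e \<longleftrightarrow>
        bucket m (landing m (occupied m h k) (h (Suc k))) t = bucket m e t"
      using inj_on_eq_iff[OF bij_betw_imp_inj_on[OF bij_betw_bucket[OF m]] landing_in[OF m] e] by metis
    thus "\<Psi> (\<lambda>x\<in>{1..Suc k}. bucket m (h x) t) (bucket m e t) = \<Psi> h e"
      using m by (simp add: \<Psi>_def occupied_rotate displacement_rotate landing_image occupied_subset)
  qed
  also have "(\<Sum>h\<in>hash_functions m (Suc k). \<Psi> h m) = (\<Sum>g\<in>hash_functions m k. G (occupied m g k))"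
    unfolding sum_hash_functions_Suc \<Psi>_def G_def
    by (intro sum.cong refl) (simp add: displacement_def occupied_fun_upd)
  \<comment> \<open>A key never lands in an occupied bucket, so \<open>G\<close> vanishes when
    \<open>m\<close> is already full.\<close>
  also have "\<dots> = (\<Sum>g\<in>{h \<in> hash_functions m k. m \<notin> occupied m h k}. G (occupied m g k))"
  proof (rule sum.mono_neutral_right)
    show "\<forall>g\<in>hash_functions m k - {h \<in> hash_functions m k. m \<notin> occupied m h k}. G (occupied m g k) = 0"
    proof
      fix g assume g: "g \<in> hash_functions m k - {h \<in> hash_functions m k. m \<notin> occupied m h k}"
      have "card (occupied m g k) = k" using g assms by (intro card_occupied) (auto simp: PiE_iff)
      hence "landing m (occupied m g k) a \<notin> occupied m g k" if "a \<in> {1..m}" for a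
        using that assms by (intro landing_notin[OF occupied_subset[OF m]]) auto
      hence "landing m (occupied m g k) a \<noteq> m" if "a \<in> {1..m}" for a using that g by force
      thus "G (occupied m g k) = 0" unfolding G_def by (intro sum.neutral) auto
    qed
  qed auto
  also have "\<dots> = (\<Sum>S\<in>Pow {1..<m}. of_nat (fillings k S) * G S)"
    using assms by (intro sum_occupied) auto
  \<comment> \<open>Since \<open>k < m - 1\<close>, the \<open>k\<close> keys leave a gap below
    \<open>m\<close>, and the full set contributes nothing.\<close>
  also have "\<dots> = (\<Sum>p\<in>{1..<m}. \<Sum>A\<in>Pow {1..<p}. of_nat (fillings k (A \<union> {p<..<m})) * G (A \<union> {p<..<m}))"
    using assms by (intro sum_Pow_last_gap) (simp add: fillings_eq_0)
  also have "\<dots> = (\<Sum>p\<in>{1..<m}. of_nat ((k choose (m - p - 1)) * (m - p) ^ (m - p - 2)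
      * last_empty p (Suc k - (m - p))) * (\<Sum>d<m - p. q ^ d))"
  proof (rule sum.cong[OF refl])
    fix p assume p: "p \<in> {1..<m}"
    \<comment> \<open>The number of full buckets between the gap and \<open>m\<close>, that is
      \<open>j - 1\<close>.\<close>
    define l where "l = m - p - 1"
    have ml: "m = Suc (p + l)" "m - p = Suc l" using p by (auto simp: l_def)
    have split: "fillings k (A \<union> {p<..<m}) = (k choose l) * Suc l ^ (l - 1) * fillings (k - l) A"
      if A: "A \<in> Pow {1..<p}" for A
    proof -
      have fin: "finite A" using A finite_subset by auto
      have disj: "A \<inter> {p<..<m} = {}" and c: "card {p<..<m} = l" using A ml by auto
      show ?thesis
      proof (cases "card A + l = k")
        case True
        hence "fillings k (A \<union> {p<..<m}) = (k choose card {p<..<m}) * fillings (card A) A * fillings (card {p<..<m}) {p<..<m}"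
          using fin A c by (intro fillings_Un[of _ _ p]) auto
        thus ?thesis using True c fillings_interval[of l p] ml(1) by auto
      next
        \<comment> \<open>If the sizes do not add up, both sides vanish. For \<open>k < l\<close>
          the difference \<open>k - l\<close> truncates, but then the binomial coefficient is
          zero.\<close>
        case False
        hence "fillings k (A \<union> {p<..<m}) = 0"
          using fin disj c by (intro fillings_eq_0) (auto simp: card_Un_disjoint)
        moreover have "(k choose l) = 0 \<or> fillings (k - l) A = 0"
        proof (cases "k < l")
          case False
          thus ?thesis using fin \<open>card A + l \<noteq> k\<close> by (intro disjI2 fillings_eq_0) auto
        qed (simp add: binomial_eq_0)
        ultimately show ?thesis by auto
      qed
    qed
    have "(\<Sum>A\<in>Pow {1..<p}. of_nat (fillings k (A \<union> {p<..<m})) * G (A \<union> {p<..<m})) =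
        (\<Sum>A\<in>Pow {1..<p}. of_nat ((k choose l) * Suc l ^ (l - 1) * fillings (k - l) A) * (\<Sum>d<m - p. q ^ d))"
      using split sum_landing_last[OF p, of _ q] by (intro sum.cong) (auto simp: G_def)
    also have "\<dots> = of_nat ((k choose l) * Suc l ^ (l - 1) * (\<Sum>A\<in>Pow {1..<p}. fillings (k - l) A))
        * (\<Sum>d<m - p. q ^ d)"
      by (simp only: sum_distrib_right[symmetric] of_nat_sum[symmetric] sum_distrib_left[symmetric])
    also have "(\<Sum>A\<in>Pow {1..<p}. fillings (k - l) A) = last_empty p (k - l)"
      using p assms ml by (intro last_empty_eq_sum_fillings[symmetric]) auto
    finally show "(\<Sum>A\<in>Pow {1..<p}. of_nat (fillings k (A \<union> {p<..<m})) * G (A \<union> {p<..<m})) =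
        of_nat ((k choose (m - p - 1)) * (m - p) ^ (m - p - 2) * last_empty p (Suc k - (m - p)))
        * (\<Sum>d<m - p. q ^ d)"
      unfolding ml(2) by simp
  qed
  also have "\<dots> = (\<Sum>j\<in>{1..<m}. of_nat ((k choose (j - 1)) * j ^ (j - 2) * last_empty (m - j) (Suc k - j))
      * (\<Sum>d<j. q ^ d))"
    by (rule sum.reindex_bij_witness[of _ "\<lambda>j. m - j" "\<lambda>p. m - p"]) auto
  finally show ?thesis .
qed

section \<open>Summation over the marked key\<close>

lemma sum_displacement_extend:
  fixes q :: "'b :: comm_semiring_1"
  assumes "1 \<le> k" "k \<le> n"
  shows "(\<Sum>h\<in>hash_functions m n. q ^ displacement m h k) =
    of_nat m ^ (n - k) * (\<Sum>h\<in>hash_functions m k. q ^ displacement m h k)"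
  using assms(2)
proof (induction n rule: dec_induct)
  case (step n)
  \<comment> \<open>Keys inserted after \<open>k\<close> cannot change its displacement, and each
    has \<open>m\<close> free addresses.\<close>
  have "displacement m (g(Suc n := a)) k = displacement m g k" for g a
    using step assms(1) by (intro displacement_cong) auto
  hence "(\<Sum>h\<in>hash_functions m (Suc n). q ^ displacement m h k) =
      of_nat m * (\<Sum>h\<in>hash_functions m n. q ^ displacement m h k)"
    by (simp add: sum_hash_functions_Suc sum_distrib_left)
  thus ?case using step by (simp add: Suc_diff_le mult_ac)
qed simp

text \<open>After \<open>n\<close> keys exactly one of the \<open>n + 1\<close> buckets is empty;
  rotation moves it to \<open>m\<close> without changing any displacement.\<close>

lemma sum_almost_full_rotate:
  fixes q :: "'b :: comm_semiring_1"
  assumes "m = Suc n" "x \<in> {1..n}"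
  shows "of_nat m * (\<Sum>h\<in>almost_full_tables m. q ^ displacement m h x) =
    (\<Sum>h\<in>hash_functions m n. q ^ displacement m h x)"
proof -
  have m: "m > 0" using assms by simp
  define \<Psi> where "\<Psi> h e = (if e \<notin> occupied m h n then q ^ displacement m h x else 0)" for h e
  have "(\<Sum>h\<in>almost_full_tables m. q ^ displacement m h x) = (\<Sum>h\<in>hash_functions m n. \<Psi> h m)"
    using assms(1) by (simp add: almost_full_tables_def \<Psi>_def sum.If_cases Int_def)
  hence "of_nat m * (\<Sum>h\<in>almost_full_tables m. q ^ displacement m h x) =
      of_nat m * (\<Sum>h\<in>hash_functions m n. \<Psi> h m)" by simp
  also have "\<dots> = (\<Sum>h\<in>hash_functions m n. \<Sum>e=1..m. \<Psi> h e)"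
  proof (rule sum_rotation_invariant[OF m, symmetric])
    fix h e t assume "h \<in> hash_functions m n" and e: "e \<in> {1..m}"
    show "\<Psi> (\<lambda>x\<in>{1..n}. bucket m (h x) t) (bucket m e t) = \<Psi> h e"
      using bucket_in_rotate_iff[OF m occupied_subset[OF m] e]
      by (simp add: \<Psi>_def displacement_rotate[OF m assms(2)] occupied_rotate[OF m order_refl])
  qed
  also have "\<dots> = (\<Sum>h\<in>hash_functions m n. q ^ displacement m h x)"
  proof (rule sum.cong[OF refl])
    fix h assume h: "h \<in> hash_functions m n"
    have c: "card (occupied m h n) = n" using h assms by (intro card_occupied) (auto simp: PiE_iff)
    have "card ({1..m} - occupied m h n) = 1"
      using c occupied_subset[OF m] finite_subset[OF occupied_subset[OF m]] assms(1)
      by (subst card_Diff_subset) simp_all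
    moreover have "(\<Sum>e=1..m. \<Psi> h e) = (\<Sum>e\<in>{1..m} - occupied m h n. q ^ displacement m h x)"
      unfolding \<Psi>_def by (simp add: sum.If_cases Diff_eq Compl_eq)
    ultimately show "(\<Sum>e=1..m. \<Psi> h e) = q ^ displacement m h x" by simp
  qed
  finally show ?thesis .
qed

text \<open>Carries out the sum over the marked key \<open>k\<close>, with \<open>Suc i\<close> as
  the block parameter \<open>j\<close>. Here \<open>m\<close> is a ring element, so subtracting from
  it does not truncate; for \<open>k \<le> i\<close> the binomial coefficient vanishes.\<close>

lemma sum_binomial_telescope:
  fixes m :: "'b :: comm_ring_1"
  shows "(\<Sum>k=1..n. m ^ (n - k) * of_nat ((k - 1) choose i) * (m - of_nat k) * (m - of_nat (Suc i)) ^ (k - Suc i)) =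
    of_nat (n choose Suc i) * (m - of_nat (Suc i)) ^ (n - i)"
proof (induction n)
  case (Suc n)
  let ?r = "m - of_nat (Suc i)"
  let ?f = "\<lambda>n k. m ^ (n - k) * of_nat ((k - 1) choose i) * (m - of_nat k) * ?r ^ (k - Suc i)"
  have "(\<Sum>k=1..Suc n. ?f (Suc n) k) = (\<Sum>k=1..n. ?f (Suc n) k) + ?f (Suc n) (Suc n)"
    by simp
  also have "(\<Sum>k=1..n. ?f (Suc n) k) = m * (\<Sum>k=1..n. ?f n k)"
    by (simp add: sum_distrib_left Suc_diff_le mult_ac cong: sum.cong_simp)
  also have "\<dots> = m * (of_nat (n choose Suc i) * ?r ^ (n - i))" by (simp only: Suc.IH)
  also have "m * (of_nat (n choose Suc i) * ?r ^ (n - i)) + ?f (Suc n) (Suc n) =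
      (m * of_nat (n choose Suc i) + of_nat (n choose i) * (m - of_nat (Suc n))) * ?r ^ (n - i)"
    by (simp add: algebra_simps)
  also have "\<dots> = of_nat (Suc n choose Suc i) * ?r ^ (Suc n - i)"
  proof (cases "i \<le> n")
    case True
    \<comment> \<open>Absorption turns \<open>Suc n * (n choose i)\<close> into \<open>Suc i\<close>
      times the larger coefficient; with Pascal's rule the two terms merge.\<close>
    have "of_nat (Suc n * (n choose i)) = (of_nat ((Suc n choose Suc i) * Suc i) :: 'b)"
      by (simp only: Suc_times_binomial_eq)
    hence "m * of_nat (n choose Suc i) + of_nat (n choose i) * (m - of_nat (Suc n)) =
        of_nat (Suc n choose Suc i) * ?r"
      by (simp add: algebra_simps)
    thus ?thesis using True by (simp add: Suc_diff_le mult_ac)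
  qed (simp add: binomial_eq_0)
  finally show ?case .
qed simp

text \<open>Rotating the empty bucket and rotating the bucket of the marked key each yield a factor
  \<open>m\<close>, and these cancel. Exchanging the sums then lets the weights of each
  \<open>j\<close> telescope over \<open>k\<close>.\<close>

lemma sum_almost_full_displacement:
  fixes q :: "'a :: field_char_0"
  shows "(\<Sum>(h, x)\<in>almost_full_tables (n + 1) \<times> {1..n}. q ^ displacement (n + 1) h x) =
    (\<Sum>j=1..n. of_nat ((n choose j) * j ^ (j - 2) * (n + 1 - j) ^ (n - j)) * (\<Sum>d<j. q ^ d))"
proof -
  define m where "m = n + 1"
  let ?c = "\<lambda>k j. of_nat ((k - 1 choose (j - 1)) * last_empty (m - j) (k - j)) :: 'a"
  have key: "(\<Sum>h\<in>almost_full_tables m. q ^ displacement m h k) =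
      (\<Sum>j=1..n. of_nat m ^ (n - k) * ?c k j * (of_nat (j ^ (j - 2)) * (\<Sum>d<j. q ^ d)))"
    if k: "k \<in> {1..n}" for k
  proof -
    have "of_nat m * (\<Sum>h\<in>almost_full_tables m. q ^ displacement m h k) =
        (\<Sum>h\<in>hash_functions m n. q ^ displacement m h k)"
      using k by (intro sum_almost_full_rotate) (auto simp: m_def)
    also have "\<dots> = of_nat m ^ (n - k) * (\<Sum>h\<in>hash_functions m k. q ^ displacement m h k)"
      using k by (intro sum_displacement_extend) auto
    also have "(\<Sum>h\<in>hash_functions m k. q ^ displacement m h k) =
        of_nat m * (\<Sum>j\<in>{1..<m}. of_nat ((k - 1 choose (j - 1)) * j ^ (j - 2) * last_empty (m - j) (k - j))
          * (\<Sum>d<j. q ^ d))"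
    proof -
      have "Suc (k - 1) = k" "k < m" using k by (auto simp: m_def)
      thus ?thesis using sum_last_key_displacement[of "k - 1" m q] by simp
    qed
    also have "{1..<m} = {1..n}" by (auto simp: m_def)
    finally have "of_nat m * (\<Sum>h\<in>almost_full_tables m. q ^ displacement m h k) =
      of_nat m * (\<Sum>j=1..n. of_nat m ^ (n - k) * ?c k j * (of_nat (j ^ (j - 2)) * (\<Sum>d<j. q ^ d)))"
      by (simp add: sum_distrib_left mult_ac)
    moreover have "of_nat m \<noteq> (0 :: 'a)" unfolding of_nat_eq_0_iff by (simp add: m_def)
    ultimately show ?thesis by simp
  qed
  have weight: "(\<Sum>k=1..n. of_nat m ^ (n - k) * ?c k j) = of_nat ((n choose j) * (m - j) ^ (n - j))"
    if j: "j \<in> {1..n}" for j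
  proof -
    have r: "(of_nat (m - j) :: 'a) = of_nat m - of_nat j" using j by (simp add: m_def of_nat_diff)
    \<comment> \<open>The nonzero factor \<open>m - j\<close> makes \<open>mult_last_empty\<close>
      applicable and is cancelled at the end.\<close>
    have "of_nat (m - j) * (of_nat m ^ (n - k) * ?c k j) =
        of_nat m ^ (n - k) * of_nat (k - 1 choose (j - 1)) * (of_nat m - of_nat k) * (of_nat m - of_nat j) ^ (k - j)"
      if k: "k \<in> {1..n}" for k
    proof (cases "j \<le> k")
      case True
      have "(m - j) * last_empty (m - j) (k - j) = (m - k) * (m - j) ^ (k - j)"
        using mult_last_empty[of "k - j" "m - j"] k j True by (simp add: m_def)
      hence "of_nat (m - j) * of_nat (last_empty (m - j) (k - j)) = (of_nat (m - k) * of_nat (m - j) ^ (k - j) :: 'a)"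
        by (simp only: of_nat_mult[symmetric] of_nat_power[symmetric])
      moreover have "(of_nat (m - k) :: 'a) = of_nat m - of_nat k" using k by (simp add: m_def of_nat_diff)
      ultimately show ?thesis by (simp add: r mult_ac)
    next
      \<comment> \<open>A block of \<open>j - 1\<close> full buckets needs as many earlier keys, so
        \<open>k < j\<close> contributes nothing.\<close>
      case False
      hence "(k - 1 choose (j - 1)) = 0" using k by (intro binomial_eq_0) auto
      thus ?thesis by simp
    qed
    hence "of_nat (m - j) * (\<Sum>k=1..n. of_nat m ^ (n - k) * ?c k j) =
        (\<Sum>k=1..n. of_nat m ^ (n - k) * of_nat (k - 1 choose (j - 1)) * (of_nat m - of_nat k)
          * (of_nat m - of_nat j) ^ (k - j))"
      by (subst sum_distrib_left) (rule sum.cong[OF refl])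
    also have "\<dots> = of_nat (n choose j) * (of_nat m - of_nat j) ^ Suc (n - j)"
    proof -
      have "Suc (j - 1) = j" "n - (j - 1) = Suc (n - j)" using j by auto
      thus ?thesis using sum_binomial_telescope[of "of_nat m :: 'a" n "j - 1"] by (simp only:)
    qed
    also have "\<dots> = of_nat (m - j) * of_nat ((n choose j) * (m - j) ^ (n - j))"
      by (simp add: r mult_ac)
    finally show ?thesis using j by (simp add: m_def)
  qed
  have "(\<Sum>(h, x)\<in>almost_full_tables m \<times> {1..n}. q ^ displacement m h x) =
      (\<Sum>k=1..n. \<Sum>h\<in>almost_full_tables m. q ^ displacement m h k)"
    by (subst sum.swap) (simp add: sum.cartesian_product)
  also have "\<dots> = (\<Sum>k=1..n. \<Sum>j=1..n. of_nat m ^ (n - k) * ?c k j * (of_nat (j ^ (j - 2)) * (\<Sum>d<j. q ^ d)))"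
    by (rule sum.cong[OF refl key])
  also have "\<dots> = (\<Sum>j=1..n. \<Sum>k=1..n. of_nat m ^ (n - k) * ?c k j * (of_nat (j ^ (j - 2)) * (\<Sum>d<j. q ^ d)))"
    by (rule sum.swap)
  also have "\<dots> = (\<Sum>j=1..n. of_nat ((n choose j) * (m - j) ^ (n - j)) * (of_nat (j ^ (j - 2)) * (\<Sum>d<j. q ^ d)))"
    by (rule sum.cong[OF refl]) (simp only: sum_distrib_right[symmetric] weight)
  finally show ?thesis by (simp add: m_def mult_ac)
qed

subsection \<open>Generating functions\<close>

abbreviation tree_fps_at :: "'a \<Rightarrow> 'a :: field_char_0 fps" where
  "tree_fps_at c \<equiv> tree_fps oo (fps_X * fps_const c)"

lemma tree_fps_at_nth:
  "tree_fps_at c $ n = (if n = 0 then 0 else c ^ n * of_nat (n ^ (n - 1)) / fact n)"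
proof -
  have "tree_fps_at c = tree_fps oo (fps_const c * fps_X)" by (simp only: mult.commute)
  hence "tree_fps_at c $ n = c ^ n * tree_fps $ n" by (simp only: fps_nth_compose_linear)
  thus ?thesis by (simp add: tree_fps_def)
qed

text \<open>The series \<open>S\<close> of the overview. Its constant term is zero through the empty
  inner sum; at \<open>n = 1\<close> the exponent truncates to 0.\<close>

definition block_fps :: "'a \<Rightarrow> 'a \<Rightarrow> 'a :: field_char_0 fps" where
  "block_fps w q = Abs_fps (\<lambda>n. w ^ n * of_nat (n ^ (n - 2)) * (\<Sum>d<n. q ^ d) / fact n)"

text \<open>The binomial coefficients in \<open>sum_almost_full_displacement\<close> are those of a
  product of exponential generating functions; \<open>(n + 1 - j) ^ (n - j)\<close> comes from the
  derivative of the tree function.\<close>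

lemma FC_eq_block_fps: "FC w q = block_fps w q * fps_deriv (tree_fps_at w)"
proof (rule fps_ext)
  fix n
  show "FC w q $ n = (block_fps w q * fps_deriv (tree_fps_at w)) $ n"
  proof (cases "n = 0")
    case False
    have "(block_fps w q * fps_deriv (tree_fps_at w)) $ n =
        (\<Sum>j=0..n. block_fps w q $ j * fps_deriv (tree_fps_at w) $ (n - j))"
      by (rule fps_mult_nth)
    also have "\<dots> = (\<Sum>j=1..n. block_fps w q $ j * fps_deriv (tree_fps_at w) $ (n - j))"
      by (rule sum.mono_neutral_right) (auto simp: block_fps_def not_le)
    also have "\<dots> = (\<Sum>j=1..n. of_nat ((n choose j) * j ^ (j - 2) * (n + 1 - j) ^ (n - j)) * (\<Sum>d<j. q ^ d)
        * (w ^ (n + 1) / fact n))"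
    proof (rule sum.cong[OF refl])
      fix j assume j: "j \<in> {1..n}"
      define i where "i = n - j"
      have n: "n = i + j" using j by (simp add: i_def)
      have deriv: "fps_deriv (tree_fps_at w) $ i = w ^ (i + 1) * of_nat ((i + 1) ^ i) / fact i"
      proof -
        define c where "c = (of_nat (i + 1) :: 'a)"
        have "c \<noteq> 0" unfolding c_def of_nat_eq_0_iff by simp
        moreover have "fact (i + 1) = c * fact i"
          unfolding c_def Suc_eq_plus1[symmetric] by (rule fact_Suc)
        ultimately show ?thesis unfolding fps_deriv_nth tree_fps_at_nth c_def[symmetric] by simp
      qed
      have binom: "(of_nat (n choose j) :: 'a) = fact n / (fact j * fact i)"
        using j by (simp add: binomial_fact i_def)
      have exps: "n + 1 - j = i + 1" "w ^ (n + 1) = w ^ j * w ^ (i + 1)"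
        using n by (simp_all add: power_add mult_ac)
      show "block_fps w q $ j * fps_deriv (tree_fps_at w) $ (n - j) =
          of_nat ((n choose j) * j ^ (j - 2) * (n + 1 - j) ^ (n - j)) * (\<Sum>d<j. q ^ d) * (w ^ (n + 1) / fact n)"
        unfolding i_def[symmetric] deriv exps of_nat_mult binom block_fps_def fps_nth_Abs_fps
        by (simp add: mult_ac)
    qed
    also have "\<dots> = (\<Sum>j=1..n. of_nat ((n choose j) * j ^ (j - 2) * (n + 1 - j) ^ (n - j)) * (\<Sum>d<j. q ^ d))
        * (w ^ (n + 1) / fact n)"
      by (rule sum_distrib_right[symmetric])
    also have "\<dots> = FC w q $ n"
      unfolding sum_almost_full_displacement[symmetric] using False by (simp add: FC_def Let_def)
    finally show ?thesis ..
  qed (simp add: FC_def block_fps_def)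
qed

section \<open>The differential equation of the tree function and the closed form\<close>

lemma card_almost_full_tables: "card (almost_full_tables (n + 1)) = (n + 1) ^ (n - 1)"
  using last_empty_full[of n] by (simp only: almost_full_tables_def last_empty_def Suc_eq_plus1 add_diff_cancel_right')

lemma tree_fps_at_deriv: "fps_X * fps_deriv (tree_fps_at w) * (1 - tree_fps_at w) = tree_fps_at w"
proof -
  \<comment> \<open>At \<open>q = 1\<close> every displacement has weight 1, so \<open>FC\<close>
    counts the almost full tables times the \<open>k\<close> possible marks.\<close>
  have FC_nth: "FC w 1 $ k = of_nat ((k + 1) ^ (k - 1) * k) * w ^ (k + 1) / fact k" if "k \<noteq> 0" for k
    using that by (simp add: FC_def Let_def split_def card_cartesian_product card_almost_full_tables)
  \<comment> \<open>The inner sum becomes \<open>n\<close> and raises the exponent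
    \<open>n - 2\<close> to \<open>n - 1\<close>; \<open>n = 1\<close> is separate because
    \<open>n - 2\<close> truncates.\<close>
  have "block_fps w 1 = tree_fps_at w"
  proof (rule fps_ext)
    fix n :: nat
    have "n ^ (n - 2) * n = n ^ (n - 1)" if "n \<noteq> 0"
    proof (cases "n = 1")
      case False
      hence "n - 1 = Suc (n - 2)" using that by auto
      thus ?thesis by (simp only: power_Suc mult.commute)
    qed simp
    hence "of_nat (n ^ (n - 2)) * of_nat n = (of_nat (n ^ (n - 1)) :: 'a)" if "n \<noteq> 0"
      using that by (metis of_nat_mult)
    thus "block_fps w 1 $ n = tree_fps_at w $ n"
      by (simp add: block_fps_def tree_fps_at_nth mult.assoc)
  qed
  hence "tree_fps_at w * fps_deriv (tree_fps_at w) = FC w 1" by (simp add: FC_eq_block_fps)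
  \<comment> \<open>The direct count is a second expression for \<open>FC w 1\<close>; equating it
    with the product form gives the differential equation.\<close>
  moreover have "fps_X * FC w 1 = fps_X * fps_deriv (tree_fps_at w) - tree_fps_at w"
  proof (rule fps_ext)
    fix n
    show "(fps_X * FC w 1) $ n = (fps_X * fps_deriv (tree_fps_at w) - tree_fps_at w) $ n"
    proof (cases n)
      case (Suc k)
      show ?thesis
      proof (cases k)
        case (Suc i)
        have "(fps_X * FC w 1) $ n = of_nat ((k + 1) ^ (k - 1) * k) * w ^ (k + 1) / fact k"
          using FC_nth[of k] \<open>n = Suc k\<close> Suc by simp
        also have "\<dots> = of_nat k * (w ^ (k + 1) * of_nat ((k + 1) ^ k) / fact (k + 1))"
        proof -
          define c where "c = (of_nat (k + 1) :: 'a)"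
          have c: "c \<noteq> 0" unfolding c_def of_nat_eq_0_iff by simp
          have "(k + 1) ^ k = (k + 1) ^ (k - 1) * (k + 1)" unfolding Suc by simp
          hence e: "of_nat ((k + 1) ^ k) = of_nat ((k + 1) ^ (k - 1)) * c" "fact (k + 1) = c * fact k"
            unfolding c_def Suc_eq_plus1[symmetric] by (metis of_nat_mult, metis fact_Suc)
          show ?thesis unfolding e of_nat_mult using c by simp
        qed
        also have "\<dots> = of_nat k * tree_fps_at w $ (k + 1)" by (simp add: tree_fps_at_nth)
        also have "\<dots> = (fps_X * fps_deriv (tree_fps_at w) - tree_fps_at w) $ n"
          using \<open>n = Suc k\<close> by (simp add: ring_distribs flip: Suc_eq_plus1)
        finally show ?thesis .
      qed (simp add: Suc FC_def tree_fps_at_nth)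
    qed (simp add: tree_fps_def)
  qed
  ultimately show ?thesis by (simp add: algebra_simps)
qed

text \<open>Both sides have the same constant term and the same image under \<open>z d/dz\<close>.
  On the left, differentiation lifts \<open>n ^ (n - 2)\<close> to \<open>n ^ (n - 1)\<close> and
  \<open>1 - q\<close> closes the geometric sum; on the right, the differential equation leaves
  multiples of the tree function.\<close>

lemma block_fps_eq:
  "fps_const (2 * (1 - q)) * block_fps w q = (1 - tree_fps_at (w * q)) ^ 2 - (1 - tree_fps_at w) ^ 2"
    (is "?l = ?r")
proof -
  have sq: "fps_X * fps_deriv ((1 - tree_fps_at c) ^ 2) = - 2 * tree_fps_at c" for c :: 'a
  proof -
    have "fps_X * fps_deriv ((1 - tree_fps_at c) ^ 2) =
        - 2 * (fps_X * fps_deriv (tree_fps_at c) * (1 - tree_fps_at c))"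
      by (simp add: power2_eq_square algebra_simps)
    thus ?thesis by (simp only: tree_fps_at_deriv)
  qed
  have "fps_X * fps_deriv ?l = 2 * tree_fps_at w - 2 * tree_fps_at (w * q)"
  proof (rule fps_ext)
    fix n :: nat
    show "(fps_X * fps_deriv ?l) $ n = (2 * tree_fps_at w - 2 * tree_fps_at (w * q)) $ n"
    proof (cases "n = 0")
      case False
      have "n * n ^ (n - 2) = n ^ (n - 1)"
      proof (cases "n = 1")
        case False
        hence "n - 1 = Suc (n - 2)" using \<open>n \<noteq> 0\<close> by auto
        thus ?thesis by (simp only: power_Suc)
      qed simp
      hence e: "of_nat n * of_nat (n ^ (n - 2)) = (of_nat (n ^ (n - 1)) :: 'a)" by (metis of_nat_mult)
      have "(fps_X * fps_deriv ?l) $ n =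
          2 * (of_nat n * of_nat (n ^ (n - 2))) * w ^ n * ((1 - q) * (\<Sum>d<n. q ^ d)) / fact n"
        using False by (simp add: block_fps_def mult_ac)
      also have "\<dots> = 2 * (of_nat (n ^ (n - 1)) * w ^ n * (1 - q ^ n) / fact n)"
        by (simp only: e one_diff_power_eq) (simp add: mult_ac)
      also have "\<dots> = (2 * tree_fps_at w - 2 * tree_fps_at (w * q)) $ n"
        using False by (simp add: tree_fps_at_nth numeral_fps_const power_mult_distrib algebra_simps diff_divide_distrib)
      finally show ?thesis .
    qed (simp add: tree_fps_at_nth)
  qed
  also have "\<dots> = fps_X * fps_deriv ?r"
    using sq[of w] sq[of "w * q"] by (simp add: algebra_simps)
  finally have "fps_deriv ?l = fps_deriv ?r" by simp
  moreover have "?l $ 0 = ?r $ 0"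
    by (simp add: block_fps_def tree_fps_at_nth power2_eq_square)
  ultimately show ?thesis by (subst (asm) fps_deriv_eq_iff) simp
qed

text \<open>The two identities eliminate the block series and the derivative within power series;
  the quotient is formed only among Laurent series.\<close>

lemma FC_closed_form:
  fixes w q :: "'a :: field_char_0"
  assumes "q \<noteq> 1"
  shows "fps_to_fls (FC w q) = ((1 - T_at (w * q)) ^ 2 - (1 - T_at w) ^ 2) * T_at w
      / (2 * fls_X * (1 - fls_const q) * (1 - T_at w))"
proof -
  let ?T = "tree_fps_at w"
  have "((1 - tree_fps_at (w * q)) ^ 2 - (1 - ?T) ^ 2) * ?T =
      fps_const (2 * (1 - q)) * block_fps w q * (fps_X * fps_deriv ?T * (1 - ?T))"
    by (simp only: block_fps_eq tree_fps_at_deriv)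
  also have "\<dots> = FC w q * (2 * fps_X * (1 - fps_const q) * (1 - ?T))"
    by (simp add: FC_eq_block_fps mult_ac numeral_fps_const flip: fps_const_mult fps_const_sub)
  finally have "fps_to_fls (((1 - tree_fps_at (w * q)) ^ 2 - (1 - ?T) ^ 2) * ?T) =
      fps_to_fls (FC w q * (2 * fps_X * (1 - fps_const q) * (1 - ?T)))" by simp
  hence "((1 - T_at (w * q)) ^ 2 - (1 - T_at w) ^ 2) * T_at w =
      fps_to_fls (FC w q) * (2 * fls_X * (1 - fls_const q) * (1 - T_at w))"
    by (simp only: T_at_def fls_times_fps_to_fls fps_to_fls_minus fps_to_fls_power fps_one_to_fls
        fps_to_fls_numeral fps_X_to_fls fps_const_to_fls)
  moreover have "1 - T_at w \<noteq> 0"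
  proof -
    \<comment> \<open>The tree function has no constant term, so this coefficient is 1.\<close>
    have "(1 - ?T) $ 0 \<noteq> 0" by (simp add: tree_fps_def)
    hence "1 - ?T \<noteq> 0" by (metis fps_zero_nth)
    hence "fps_to_fls (1 - ?T) \<noteq> 0" by (simp only: fps_to_fls_eq_0_iff not_False_eq_True)
    thus ?thesis by (simp add: T_at_def)
  qed
  moreover have "1 - fls_const q \<noteq> 0" using assms by simp
  ultimately show ?thesis by (simp add: eq_divide_eq)
qed

theorem theorem12p2:
  shows "fps_to_fls (FC var_w var_q) =
    ((1 - T_at (var_w * var_q)) ^ 2 - (1 - T_at var_w) ^ 2) * T_at var_w
      / (2 * var_z * (1 - fls_const var_q) * (1 - T_at var_w))"
proof -
  \<comment> \<open>The variable \<open>q\<close> differs from 1 in the coefficient at exponent 0,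
    which permits the division by \<open>1 - q\<close>.\<close>
  have "fls_nth (fls_X :: rat fls) 0 \<noteq> fls_nth 1 0" by simp
  hence "(fls_X :: rat fls) \<noteq> 1" by metis
  thus ?thesis unfolding var_z_def by (intro FC_closed_form) (simp add: var_q_def)
qed

end
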